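(* Consider the following three assertions. (A) Every $5$-edge-connected essentially $6$-edge-connected graph is $\langle\mathbb{Z}_3\rangle$-extendable at each of its vertices of degree $5$. (B) Every $\langle\mathbb{Z}_3\rangle$-reduced graph has minimum degree at most $4$. (C) Every $5$-edge-connected graph is $\mathbb{Z}_3$-connected. Then each of the following holds: (i) (A) implies (B); (ii) (B) implies (C).
   Context: Graphs are finite, have no loops, and may have multiple edges. An edge cut $X=[S,V(G)-S]$ of a connected graph $G$ (the set of edges with exactly one end in $S$) is essential if at least two components of $G-X$ are nontrivial (have more than one vertex). A graph is essentially $k$-edge-connected if it has no essential edge cut with fewer than $k$ edges. For an orientation $D$, $d_D^+(v)$ and $d_D^-(v)$ denote the out-degree and in-degree of $v$. A zero-sum function of $G$ is a map $\beta: V(G)\to\mathbb{Z}_3$ with $\sum_{v\in V(G)}\beta(v)=0$ in $\mathbb{Z}_3$; a $\beta$-orientation of $G$ is an orientation $D$ of $G$ with $d_D^+(v)-d_D^-(v)=\beta(v)$ in $\mathbb{Z}_3$ for every $v\in V(G)$. $G$ is $\mathbb{Z}_3$-connected if it admits a $\beta$-orientation for every zero-sum function $\beta$ of $G$. A graph is $\langle\mathbb{Z}_3\rangle$-reduced if it has no nontrivial (more than one vertex) $\mathbb{Z}_3$-connected subgraph; in particular $K_1$ is $\langle\mathbb{Z}_3\rangle$-reduced. $E_G(z_0)$ is the set of edges incident with $z_0$; a pre-orientation $D_{z_0}$ of $E_G(z_0)$ is an orientation of just these edges. $G$ is $\langle\mathbb{Z}_3\rangle$-extendable at $z_0$ if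 for every zero-sum function $\beta$ of $G$ and every pre-orientation $D_{z_0}$ of $E_G(z_0)$ with $d_{D_{z_0}}^+(z_0)-d_{D_{z_0}}^-(z_0)\equiv\beta(z_0)\pmod 3$, $D_{z_0}$ can be extended to a $\beta$-orientation of $G$. *)

theory Defs
  imports
    "Graph_Theory.Digraph"
    "HOL-Library.Numeral_Type"
    "HOL-Library.Infinite_Typeclass"
begin

text \<open>
  Undirected multigraphs: edges have an identity of their own, so parallel edges are distinct
  elements of \<open>edges G\<close> with the same set of ends. Only the values of \<open>ends G\<close> on \<open>edges G\<close> matter.
\<close>

record ('v, 'e) mgraph =
  vertices :: "'v set"
  edges :: "'e set"
  ends :: "'e \<Rightarrow> 'v set"

locale multigraph =
  fixes G :: "('v, 'e) mgraph" (structure)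
  assumes finite_vertices: "finite (vertices G)"
    and vertices_nonempty: "vertices G \<noteq> {}"
    and finite_edges: "finite (edges G)"
    and ends_in_vertices: "e \<in> edges G \<Longrightarrow> ends G e \<subseteq> vertices G"
    and card_ends: "e \<in> edges G \<Longrightarrow> card (ends G e) = 2"

definition subgraph :: "('v, 'e) mgraph \<Rightarrow> ('v, 'e) mgraph \<Rightarrow> bool" where
  "subgraph H G \<longleftrightarrow> multigraph H \<and> vertices H \<subseteq> vertices G \<and> edges H \<subseteq> edges G \<and>
     (\<forall>e\<in>edges H. ends H e = ends G e)"

definition nontrivial :: "('v, 'e) mgraph \<Rightarrow> bool" where
  "nontrivial G \<longleftrightarrow> card (vertices G) > 1"

definition incident_edges :: "('v, 'e) mgraph \<Rightarrow> 'v \<Rightarrow> 'e set" where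
  "incident_edges G v = {e \<in> edges G. v \<in> ends G e}"

definition degree :: "('v, 'e) mgraph \<Rightarrow> 'v \<Rightarrow> nat" where
  "degree G v = card (incident_edges G v)"

definition min_degree :: "('v, 'e) mgraph \<Rightarrow> nat" where
  "min_degree G = Min (degree G ` vertices G)"


definition adjacency :: "('v, 'e) mgraph \<Rightarrow> ('v \<times> 'v) set" where
  "adjacency G = {(u, v). \<exists>e\<in>edges G. ends G e = {u, v}}"

definition linked :: "('v, 'e) mgraph \<Rightarrow> ('v \<times> 'v) set" where
  "linked G = {(u, v). u \<in> vertices G \<and> v \<in> vertices G \<and> (u, v) \<in> (adjacency G)\<^sup>*}"

text \<open>A component is represented by its vertex set.\<close>

definition components :: "('v, 'e) mgraph \<Rightarrow> 'v set set" where
  "components G = vertices G // linked G"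

definition connected_graph :: "('v, 'e) mgraph \<Rightarrow> bool" where
  "connected_graph G \<longleftrightarrow> (\<forall>u\<in>vertices G. \<forall>v\<in>vertices G. (u, v) \<in> linked G)"

definition delete_edges :: "('v, 'e) mgraph \<Rightarrow> 'e set \<Rightarrow> ('v, 'e) mgraph" where
  "delete_edges G X = G\<lparr>edges := edges G - X\<rparr>"

definition cut_edges :: "('v, 'e) mgraph \<Rightarrow> 'v set \<Rightarrow> 'e set" where
  "cut_edges G S = {e \<in> edges G. card (ends G e \<inter> S) = 1}"

definition edge_cut :: "('v, 'e) mgraph \<Rightarrow> 'e set \<Rightarrow> bool" where
  "edge_cut G X \<longleftrightarrow> (\<exists>S. S \<noteq> {} \<and> S \<subset> vertices G \<and> X = cut_edges G S)"

definition essential_edge_cut :: "('v, 'e) mgraph \<Rightarrow> 'e set \<Rightarrow> bool" where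
  "essential_edge_cut G X \<longleftrightarrow> edge_cut G X \<and>
     card {C \<in> components (delete_edges G X). card C > 1} \<ge> 2"

text \<open>A one-vertex graph has no edge cut, hence counts as \<open>k\<close>-edge-connected for every \<open>k\<close>.\<close>

definition edge_connected :: "nat \<Rightarrow> ('v, 'e) mgraph \<Rightarrow> bool" where
  "edge_connected k G \<longleftrightarrow> connected_graph G \<and> \<not> (\<exists>X. edge_cut G X \<and> card X < k)"

definition essentially_edge_connected :: "nat \<Rightarrow> ('v, 'e) mgraph \<Rightarrow> bool" where
  "essentially_edge_connected k G \<longleftrightarrow>
     connected_graph G \<and> \<not> (\<exists>X. essential_edge_cut G X \<and> card X < k)"


text \<open>
  An orientation is a digraph on the same vertices and edges, so that its out- and in-degrees are
  \<^const>\<open>out_degree\<close> and \<^const>\<open>in_degree\<close>.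
\<close>

definition orientation :: "('v, 'e) mgraph \<Rightarrow> ('v, 'e) pre_digraph \<Rightarrow> bool" where
  "orientation G D \<longleftrightarrow> verts D = vertices G \<and> arcs D = edges G \<and>
     (\<forall>e\<in>edges G. ends G e = {tail D e, head D e})"

definition pre_orientation :: "('v, 'e) mgraph \<Rightarrow> 'v \<Rightarrow> ('v, 'e) pre_digraph \<Rightarrow> bool" where
  "pre_orientation G z D \<longleftrightarrow> orientation (G\<lparr>edges := incident_edges G z\<rparr>) D"

definition extends_orientation :: "('v, 'e) pre_digraph \<Rightarrow> ('v, 'e) pre_digraph \<Rightarrow> bool" where
  "extends_orientation D D' \<longleftrightarrow> verts D' \<subseteq> verts D \<and> arcs D' \<subseteq> arcs D \<and>
     (\<forall>e\<in>arcs D'. tail D e = tail D' e \<and> head D e = head D' e)"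

text \<open>The numeral type \<open>3\<close> is the ring of integers modulo 3.\<close>

definition net_out :: "('v, 'e) pre_digraph \<Rightarrow> 'v \<Rightarrow> 3" where
  "net_out D v = of_nat (out_degree D v) - of_nat (in_degree D v)"

definition zero_sum :: "('v, 'e) mgraph \<Rightarrow> ('v \<Rightarrow> 3) \<Rightarrow> bool" where
  "zero_sum G \<beta> \<longleftrightarrow> (\<Sum>v\<in>vertices G. \<beta> v) = 0"

definition beta_orientation ::
  "('v, 'e) mgraph \<Rightarrow> ('v \<Rightarrow> 3) \<Rightarrow> ('v, 'e) pre_digraph \<Rightarrow> bool" where
  "beta_orientation G \<beta> D \<longleftrightarrow> orientation G D \<and> (\<forall>v\<in>vertices G. net_out D v = \<beta> v)"

definition Z3_connected :: "('v, 'e) mgraph \<Rightarrow> bool" where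
  "Z3_connected G \<longleftrightarrow> (\<forall>\<beta>. zero_sum G \<beta> \<longrightarrow> (\<exists>D. beta_orientation G \<beta> D))"

definition Z3_reduced :: "('v, 'e) mgraph \<Rightarrow> bool" where
  "Z3_reduced G \<longleftrightarrow> \<not> (\<exists>H. subgraph H G \<and> nontrivial H \<and> Z3_connected H)"

definition Z3_extendable_at :: "('v, 'e) mgraph \<Rightarrow> 'v \<Rightarrow> bool" where
  "Z3_extendable_at G z \<longleftrightarrow>
     (\<forall>\<beta> D\<^sub>z. zero_sum G \<beta> \<and> pre_orientation G z D\<^sub>z \<and> net_out D\<^sub>z z = \<beta> z \<longrightarrow>
        (\<exists>D. beta_orientation G \<beta> D \<and> extends_orientation D D\<^sub>z))"

end

theory Submission
  imports Defs
begin

text \<open>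
  (i) In a \<open>\<langle>\<int>\<^sub>3\<rangle>\<close>-reduced graph of minimum degree at least 5, choose a smallest set \<open>S\<close> of at least
  two vertices with at most 5 edges leaving it; \<open>S\<close> exists because the whole vertex set
  qualifies. Join \<open>S\<close> to a new vertex \<open>z\<close> by the edges leaving \<open>S\<close> and by as many new edges as are
  needed to give \<open>z\<close> degree exactly 5. By the choice of \<open>S\<close>, (A) applies at \<open>z\<close>, and deleting \<open>z\<close>
  from the extensions of a single pre-orientation shows that the subgraph induced on \<open>S\<close> is
  \<open>\<int>\<^sub>3\<close>-connected.

  (ii) By induction on the number of vertices: (B) yields a nontrivial \<open>\<int>\<^sub>3\<close>-connected subgraph \<open>H\<close>;
  the contraction \<open>G/H\<close> is again 5-edge-connected, and its orientations lift to \<open>G\<close>, where \<open>H\<close>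
  absorbs any boundary left on its vertices.
\<close>

section \<open>Cuts and connectivity\<close>

lemma (in multigraph) edge_endsE:
  assumes "e \<in> edges G"
  obtains a b where "ends G e = {a, b}" "a \<noteq> b" "a \<in> vertices G" "b \<in> vertices G"
  using card_ends[OF assms] ends_in_vertices[OF assms] by (auto simp: card_2_iff)

lemma card_pair_Int_eq_1_iff:
  assumes "a \<noteq> b"
  shows "card ({a, b} \<inter> S) = 1 \<longleftrightarrow> (a \<in> S) \<noteq> (b \<in> S)"
  using assms by (cases "a \<in> S"; cases "b \<in> S") auto

lemma (in multigraph) cut_edges_Diff: "cut_edges G (vertices G - S) = cut_edges G S"
proof -
  have "card (ends G e \<inter> (vertices G - S)) = 1 \<longleftrightarrow> card (ends G e \<inter> S) = 1"
    if e: "e \<in> edges G" for e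
  proof -
    obtain a b where "ends G e = {a, b}" "a \<noteq> b" "a \<in> vertices G" "b \<in> vertices G"
      using edge_endsE[OF e] .
    then show ?thesis
      by (auto simp: card_pair_Int_eq_1_iff simp del: One_nat_def)
  qed
  then show ?thesis
    unfolding cut_edges_def by blast
qed

lemma (in multigraph) cut_edges_vertices: "cut_edges G (vertices G) = {}"
  using cut_edges_Diff[of "{}"] by (simp add: cut_edges_def)

lemma (in multigraph) finite_cut_edges: "finite (cut_edges G S)"
  using finite_edges by (simp add: cut_edges_def)

lemma cut_edges_singleton: "cut_edges G {v} = incident_edges G v"
proof -
  have "card (A \<inter> {v}) = 1 \<longleftrightarrow> v \<in> A" for A
    by (cases "v \<in> A") auto
  then show ?thesis
    by (simp add: cut_edges_def incident_edges_def)
qed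

lemma (in multigraph) equiv_linked: "equiv (vertices G) (linked G)"
proof -
  have "sym ((adjacency G)\<^sup>*)"
    by (rule sym_rtrancl) (auto simp: sym_def adjacency_def insert_commute)
  then show ?thesis
    by (auto simp: equiv_def refl_on_def sym_def trans_def linked_def intro: rtrancl_trans)
qed

text \<open>An edge with one end in a class of \<open>linked\<close> draws its other end into that
  class. This serves twice: to derive connectedness from bounds on cuts, and to place the cut of a
  component of \<open>delete_edges G X\<close> inside \<open>X\<close>.\<close>

lemma (in multigraph) cut_edges_component:
  assumes "C \<in> components G"
  shows "cut_edges G C = {}"
proof -
  obtain u where u: "u \<in> vertices G" and C: "C = linked G `` {u}"
    using assms unfolding components_def by (rule quotientE) blast
  have step: "b \<in> C" if "a \<in> C" "e \<in> edges G" "ends G e = {a, b}" for e a b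
  proof -
    have "(a, b) \<in> adjacency G"
      using that by (auto simp: adjacency_def)
    moreover have "b \<in> vertices G"
      using ends_in_vertices[of e] that by auto
    ultimately show ?thesis
      using that(1) unfolding C by (auto simp: linked_def)
  qed
  have "card (ends G e \<inter> C) \<noteq> 1" if e: "e \<in> edges G" for e
  proof -
    obtain a b where ab: "ends G e = {a, b}" "a \<noteq> b"
      using edge_endsE[OF e] by metis
    then have "a \<in> C \<longleftrightarrow> b \<in> C"
      using step[of a e b] step[of b e a] e by (auto simp: insert_commute)
    then show ?thesis
      using ab by (simp add: card_pair_Int_eq_1_iff del: One_nat_def)
  qed
  then show ?thesis
    by (auto simp: cut_edges_def)
qed

lemma edge_connected_cut:
  assumes "edge_connected k G" "S \<noteq> {}" "S \<subset> vertices G"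
  shows "k \<le> card (cut_edges G S)"
  using assms unfolding edge_connected_def edge_cut_def by (auto simp: not_less)

text \<open>Connectedness follows from the cut bound: if \<open>u\<close> and \<open>v\<close> were
  not linked, the component of \<open>u\<close> would be a proper vertex set with an empty cut,
  against \<open>0 < k\<close>.\<close>

lemma (in multigraph) edge_connectedI:
  assumes cut: "\<And>S. S \<noteq> {} \<Longrightarrow> S \<subset> vertices G \<Longrightarrow> k \<le> card (cut_edges G S)"
    and "0 < k"
  shows "edge_connected k G"
proof -
  have "(u, v) \<in> linked G" if "u \<in> vertices G" "v \<in> vertices G" for u v
  proof (rule ccontr)
    let ?C = "linked G `` {u}"
    assume "(u, v) \<notin> linked G"
    then have "?C \<subset> vertices G"
      using that by (auto simp: linked_def)
    moreover have "u \<in> ?C"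
      using that by (simp add: linked_def)
    moreover have "cut_edges G ?C = {}"
      using that by (intro cut_edges_component) (simp add: components_def quotientI)
    ultimately show False
      using cut[of ?C] \<open>0 < k\<close> by auto
  qed
  moreover have "\<not> card X < k" if "edge_cut G X" for X
    using that cut unfolding edge_cut_def by (auto simp: not_less)
  ultimately show ?thesis
    unfolding edge_connected_def connected_graph_def by blast
qed

lemma (in multigraph) multigraph_delete_edges: "multigraph (delete_edges G X)"
  using finite_vertices vertices_nonempty finite_edges ends_in_vertices card_ends
  by (auto simp: multigraph_def delete_edges_def)

text \<open>Of two nontrivial components left by an essential cut, one avoids \<open>z\<close> and misses a vertex other
  than \<open>z\<close>.\<close>

lemma (in multigraph) essentially_edge_connectedI:
  assumes "connected_graph G"
    and cut: "\<And>T. T \<subset> vertices G - {z} \<Longrightarrow> 2 \<le> card T \<Longrightarrow> k \<le> card (cut_edges G T)"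
  shows "essentially_edge_connected k G"
proof -
  have "k \<le> card X" if X: "essential_edge_cut G X" for X
  proof -
    let ?D = "delete_edges G X"
    let ?\<C> = "{C \<in> components ?D. card C > 1}"
    interpret D: multigraph ?D
      by (rule multigraph_delete_edges)
    have vD: "vertices ?D = vertices G"
      by (simp add: delete_edges_def)
    have "\<not> card ?\<C> \<le> Suc 0"
      using X by (simp add: essential_edge_cut_def)
    \<comment> \<open>\<open>card\<close> is 0 on infinite sets, so the lower bound 2 in the
      definition of an essential cut already gives finiteness.\<close>
    moreover have "finite ?\<C>"
      using X by (intro card_ge_0_finite) (auto simp: essential_edge_cut_def)
    ultimately obtain A B where AB: "A \<in> ?\<C>" "B \<in> ?\<C>" "A \<noteq> B"
      by (auto simp: card_le_Suc0_iff_eq)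
    have disj: "A \<inter> B = {}"
      using AB quotient_disj[OF D.equiv_linked] unfolding components_def by blast
    have sub: "A \<subseteq> vertices G" "B \<subseteq> vertices G"
      using AB in_quotient_imp_subset[OF D.equiv_linked] vD unfolding components_def by auto
    have bound: "k \<le> card X"
      if C: "C \<in> ?\<C>" and C': "C' \<in> ?\<C>" and CC': "C \<inter> C' = {}" "C \<subseteq> vertices G" "C' \<subseteq> vertices G"
        and z: "z \<notin> C" for C C'
    proof -
      have "\<not> C' \<subseteq> {z}"
        using C' card_mono[of "{z}" C'] by auto
      then have "C \<subset> vertices G - {z}"
        using CC' z by blast
      then have "k \<le> card (cut_edges G C)"
        using cut C by auto
      \<comment> \<open>No edge of \<open>delete_edges G X\<close> leaves its component
        \<open>C\<close>, so every edge of \<open>G\<close> that leaves \<open>C\<close> lies in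
        \<open>X\<close>.\<close>
      also have "cut_edges G C \<subseteq> X"
        using D.cut_edges_component[of C] C by (auto simp: cut_edges_def delete_edges_def)
      then have "card (cut_edges G C) \<le> card X"
        using X finite_cut_edges
        by (intro card_mono) (auto simp: essential_edge_cut_def edge_cut_def)
      finally show ?thesis .
    qed
    show ?thesis
      using bound[of A B] bound[of B A] AB disj sub by blast
  qed
  then show ?thesis
    using assms(1) unfolding essentially_edge_connected_def by (meson not_le)
qed

lemma (in multigraph) edge_connected_degree:
  assumes "edge_connected k G" "nontrivial G" "v \<in> vertices G"
  shows "k \<le> degree G v"
proof -
  have "{v} \<noteq> vertices G"
    using assms(2) by (auto simp: nontrivial_def dest: sym)
  then have "{v} \<subset> vertices G"
    using assms(3) by blast
  then show ?thesis
    using edge_connected_cut[OF assms(1), of "{v}"] by (simp add: degree_def cut_edges_singleton)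
qed

lemma (in multigraph) min_degree_ge_iff:
  "k \<le> min_degree G \<longleftrightarrow> (\<forall>v\<in>vertices G. k \<le> degree G v)"
  using finite_vertices vertices_nonempty by (simp add: min_degree_def)

lemma (in multigraph) nontrivial_if_incident_edges:
  assumes "incident_edges G v \<noteq> {}"
  shows "nontrivial G"
proof -
  obtain e where "e \<in> edges G"
    using assms by (auto simp: incident_edges_def)
  then have "2 \<le> card (vertices G)"
    using card_mono[OF finite_vertices ends_in_vertices[of e]] card_ends[of e] by simp
  then show ?thesis
    by (simp add: nontrivial_def)
qed

section \<open>Net out-degrees along a set of edges\<close>

text \<open>Tails, heads and the edge set are separate arguments, so that net out-degrees can be
  split over disjoint edge sets and compared between digraphs that agree only on some edges.\<close>

definition net_on :: "('e \<Rightarrow> 'v) \<Rightarrow> ('e \<Rightarrow> 'v) \<Rightarrow> 'e set \<Rightarrow> 'v \<Rightarrow> 3" where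
  "net_on t h F v = (\<Sum>e\<in>F. of_bool (t e = v) - of_bool (h e = v))"

lemma net_out_eq_net_on:
  assumes "finite (arcs D)"
  shows "net_out D v = net_on (tail D) (head D) (arcs D) v"
proof -
  have "of_nat (card {e \<in> arcs D. f e = v}) = (\<Sum>e\<in>arcs D. of_bool (f e = v) :: 3)" for f
    using assms by (simp add: of_bool_def sum.If_cases Int_def)
  then show ?thesis
    by (simp add: net_out_def net_on_def out_degree_def in_degree_def out_arcs_def in_arcs_def
        sum_subtractf)
qed

lemma net_on_cong:
  assumes "F = F'" "\<And>e. e \<in> F' \<Longrightarrow> t e = t' e" "\<And>e. e \<in> F' \<Longrightarrow> h e = h' e"
  shows "net_on t h F v = net_on t' h' F' v"
  using assms unfolding net_on_def by (intro sum.cong) auto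

lemma net_on_Un:
  assumes "finite F" "finite F'" "F \<inter> F' = {}"
  shows "net_on t h (F \<union> F') v = net_on t h F v + net_on t h F' v"
  using assms unfolding net_on_def by (rule sum.union_disjoint)

text \<open>After exchanging the sums, an edge with both ends in \<open>W\<close> contributes 1 - 1
  = 0, so the total over \<open>W\<close> sees only the edges that cross its boundary.\<close>

lemma sum_net_on:
  assumes "finite W"
  shows "(\<Sum>v\<in>W. net_on t h F v) = (\<Sum>e\<in>F. of_bool (t e \<in> W) - of_bool (h e \<in> W))"
proof -
  have "(\<Sum>v\<in>W. of_bool (x = v) :: 3) = of_bool (x \<in> W)" for x
    using assms by (simp add: of_bool_def)
  then show ?thesis
    unfolding net_on_def by (subst sum.swap) (simp add: sum_subtractf)
qed

section \<open>Contraction\<close>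

definition collapse :: "'v set \<Rightarrow> 'v \<Rightarrow> 'v \<Rightarrow> 'v" where
  "collapse W w x = (if x \<in> W then w else x)"

text \<open>Edges inside \<open>W\<close> would become loops and are dropped. All others keep their
  identity, so parallel edges stay distinct and cuts compare as sets of edges.\<close>

definition contract :: "('v, 'e) mgraph \<Rightarrow> 'v set \<Rightarrow> 'v \<Rightarrow> ('v, 'e) mgraph" where
  "contract G W w = \<lparr>vertices = insert w (vertices G - W), edges = {e \<in> edges G. \<not> ends G e \<subseteq> W},
     ends = \<lambda>e. collapse W w ` ends G e\<rparr>"

lemma collapse_eq_iff:
  assumes "w \<in> W" "\<not> {a, b} \<subseteq> W"
  shows "collapse W w a = collapse W w b \<longleftrightarrow> a = b"
  using assms by (auto simp: collapse_def)

lemma (in multigraph) multigraph_contract: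
  assumes "w \<in> W" "W \<subseteq> vertices G"
  shows "multigraph (contract G W w)"
proof
  fix e assume "e \<in> edges (contract G W w)"
  then have e: "e \<in> edges G" "\<not> ends G e \<subseteq> W"
    by (auto simp: contract_def)
  obtain a b where ab: "ends G e = {a, b}" "a \<noteq> b" "a \<in> vertices G" "b \<in> vertices G"
    using edge_endsE[OF e(1)] .
  show "ends (contract G W w) e \<subseteq> vertices (contract G W w)"
    using ab assms by (auto simp: contract_def collapse_def)
  show "card (ends (contract G W w) e) = 2"
    using ab e(2) assms collapse_eq_iff[of w W a b] by (simp add: contract_def)
qed (use finite_vertices finite_edges in \<open>auto simp: contract_def\<close>)

text \<open>Pulling \<open>S\<close> back along \<open>collapse\<close> gives a nonempty proper set
  \<open>T\<close> with the same cut: an edge inside \<open>W\<close> crosses neither set, and every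
  other edge keeps two distinct ends.\<close>

lemma (in multigraph) edge_connected_contract:
  assumes w: "w \<in> W" "W \<subseteq> vertices G" and "edge_connected k G" "0 < k"
  shows "edge_connected k (contract G W w)"
proof -
  interpret C: multigraph "contract G W w"
    using multigraph_contract[OF w] .
  show ?thesis
  proof (rule C.edge_connectedI)
    fix S assume S: "S \<noteq> {}" "S \<subset> vertices (contract G W w)"
    define T where "T = {x \<in> vertices G. collapse W w x \<in> S}"
    have S_sub: "S \<subset> insert w (vertices G - W)"
      using S by (simp add: contract_def)
    have "x \<in> T \<longleftrightarrow> x \<in> S" if "x \<in> insert w (vertices G - W)" for x
      using that w by (auto simp: T_def collapse_def)
    then have "T \<noteq> {}" "T \<subset> vertices G"
      using S(1) S_sub w unfolding T_def by blast+
    then have "k \<le> card (cut_edges G T)"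
      using edge_connected_cut assms(3) by blast
    also have "cut_edges G T = cut_edges (contract G W w) S"
    proof -
      have "card (ends G e \<inter> T) = 1 \<longleftrightarrow>
          \<not> ends G e \<subseteq> W \<and> card (collapse W w ` ends G e \<inter> S) = 1" if e: "e \<in> edges G" for e
      proof -
        obtain a b where ab: "ends G e = {a, b}" "a \<noteq> b" "a \<in> vertices G" "b \<in> vertices G"
          using edge_endsE[OF e] .
        have T: "card (ends G e \<inter> T) = 1 \<longleftrightarrow> (collapse W w a \<in> S) \<noteq> (collapse W w b \<in> S)"
          using ab by (simp add: card_pair_Int_eq_1_iff T_def del: One_nat_def)
        show ?thesis
        proof (cases "ends G e \<subseteq> W")
          case True
          then show ?thesis
            using T ab by (simp add: collapse_def)
        next
          case False
          then have "collapse W w a \<noteq> collapse W w b"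
            using collapse_eq_iff[OF w(1), of a b] ab by simp
          then show ?thesis
            using T False ab(1) card_pair_Int_eq_1_iff[of "collapse W w a" "collapse W w b" S]
            by simp
        qed
      qed
      then show ?thesis
        by (auto simp: cut_edges_def contract_def)
    qed
    finally show "k \<le> card (cut_edges (contract G W w) S)" .
  qed (rule assms)
qed

text \<open>Each edge of the contraction pulls its direction back to its ends in \<open>G\<close>;
  edges inside \<open>W\<close> get an arbitrary direction.\<close>

lemma (in multigraph) lift_contract_orientation:
  assumes w: "w \<in> W" "W \<subseteq> vertices G" and D: "orientation (contract G W w) D"
  obtains t h where "\<And>e. e \<in> edges G \<Longrightarrow> ends G e = {t e, h e}"
    and "\<And>e. e \<in> edges (contract G W w) \<Longrightarrow>
      tail D e = collapse W w (t e) \<and> head D e = collapse W w (h e)"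
proof -
  have "\<exists>a b. ends G e = {a, b} \<and> (e \<in> edges (contract G W w) \<longrightarrow>
      tail D e = collapse W w a \<and> head D e = collapse W w b)" if e: "e \<in> edges G" for e
  proof -
    obtain a b where ab: "ends G e = {a, b}"
      using edge_endsE[OF e] by metis
    show ?thesis
    proof (cases "e \<in> edges (contract G W w)")
      case True
      then have "{tail D e, head D e} = ends (contract G W w) e"
        using D by (simp add: orientation_def)
      then have "{tail D e, head D e} = {collapse W w a, collapse W w b}"
        using ab by (simp add: contract_def)
      then consider "tail D e = collapse W w a" "head D e = collapse W w b"
        | "tail D e = collapse W w b" "head D e = collapse W w a"
        unfolding doubleton_eq_iff by metis
      then show ?thesis
        using ab by cases (blast, metis insert_commute)
    qed (use ab in blast)
  qed
  then obtain t h where "\<And>e. e \<in> edges G \<Longrightarrow> ends G e = {t e, h e} \<and>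
      (e \<in> edges (contract G W w) \<longrightarrow> tail D e = collapse W w (t e) \<and> head D e = collapse W w (h e))"
    by metis
  moreover have "edges (contract G W w) \<subseteq> edges G"
    by (auto simp: contract_def)
  ultimately show ?thesis
    using that[of t h] by blast
qed

text \<open>An orientation of the contraction settles the vertices outside \<open>H\<close> and the
  total over \<open>H\<close>. What is still missing at single vertices of \<open>H\<close> sums to
  0 and is supplied by the edges of \<open>H\<close> alone.\<close>

lemma (in multigraph) Z3_connected_if_contract:
  assumes H: "subgraph H G" "Z3_connected H" and w: "w \<in> vertices H"
    and C: "Z3_connected (contract G (vertices H) w)"
  shows "Z3_connected G"
  unfolding Z3_connected_def
proof (intro allI impI)
  fix \<beta> assume zero: "zero_sum G \<beta>"
  define W where "W = vertices H"
  let ?c = "collapse W w"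
  let ?K = "contract G W w"
  have WG: "W \<subseteq> vertices G" and HG: "edges H \<subseteq> edges G"
    and ends_H: "\<And>e. e \<in> edges H \<Longrightarrow> ends H e = ends G e"
    using H by (auto simp: subgraph_def W_def)
  interpret H: multigraph H
    using H by (simp add: subgraph_def)
  have wW: "w \<in> W"
    using w by (simp add: W_def)
  have fin: "finite W" "finite (vertices G - W)"
    using finite_vertices WG finite_subset by auto
  \<comment> \<open>The representative \<open>w\<close> receives the whole demand of
    \<open>W\<close>, which keeps the function zero-sum on the contraction.\<close>
  define \<beta>' where "\<beta>' v = (if v = w then \<Sum>u\<in>W. \<beta> u else \<beta> v)" for v
  have "(\<Sum>v\<in>vertices ?K. \<beta>' v) = (\<Sum>u\<in>W. \<beta> u) + (\<Sum>v\<in>vertices G - W. \<beta>' v)"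
    using fin wW by (simp add: contract_def \<beta>'_def)
  also have "(\<Sum>v\<in>vertices G - W. \<beta>' v) = (\<Sum>v\<in>vertices G - W. \<beta> v)"
    using wW by (intro sum.cong) (auto simp: \<beta>'_def)
  also have "(\<Sum>u\<in>W. \<beta> u) + (\<Sum>v\<in>vertices G - W. \<beta> v) = 0"
    using zero sum.subset_diff[OF WG finite_vertices, of \<beta>] by (simp add: zero_sum_def add.commute)
  finally obtain D where D: "beta_orientation ?K \<beta>' D"
    using C unfolding Z3_connected_def zero_sum_def W_def by blast
  then have oD: "orientation ?K D"
    by (simp add: beta_orientation_def)
  obtain t h where ends_th: "\<And>e. e \<in> edges G \<Longrightarrow> ends G e = {t e, h e}"
    and lift: "\<And>e. e \<in> edges ?K \<Longrightarrow> tail D e = ?c (t e) \<and> head D e = ?c (h e)"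
    using lift_contract_orientation[OF wW WG oD] by metis
  \<comment> \<open>\<open>H\<close> need not be induced: \<open>F\<close> also holds the edges
    inside \<open>W\<close> that are outside \<open>H\<close>. Their arbitrary directions are
    counted in \<open>net_on t h F\<close> and compensated by \<open>H\<close>.\<close>
  define F where "F = edges G - edges H"
  have finF: "finite F"
    using finite_edges by (simp add: F_def)
  have K_sub: "edges ?K \<subseteq> F"
    using H.ends_in_vertices ends_H by (auto simp: F_def contract_def W_def)
  have inner: "t e \<in> W \<and> h e \<in> W" if "e \<in> F - edges ?K" for e
    using that ends_th[of e] by (auto simp: F_def contract_def)
  have arcs_D: "arcs D = edges ?K" "finite (arcs D)"
    using oD finite_edges by (auto simp: orientation_def contract_def)
  have net_D: "net_out D v = (\<Sum>e\<in>edges ?K. of_bool (?c (t e) = v) - of_bool (?c (h e) = v))" for v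
    using net_out_eq_net_on[OF arcs_D(2)] lift by (simp add: net_on_def arcs_D(1))
  have outside: "net_on t h F v = \<beta> v" if v: "v \<in> vertices G - W" for v
  proof -
    have "?c x = v \<longleftrightarrow> x = v" for x
      using v wW by (auto simp: collapse_def)
    then have "net_out D v = (\<Sum>e\<in>edges ?K. of_bool (t e = v) - of_bool (h e = v))"
      by (simp add: net_D)
    also have "\<dots> = net_on t h F v"
      unfolding net_on_def using inner v by (intro sum.mono_neutral_left[OF finF K_sub]) force
    finally have "net_out D v = net_on t h F v" .
    moreover have "v \<noteq> w" "v \<in> vertices ?K"
      using v wW by (auto simp: contract_def)
    ultimately show ?thesis
      using D by (simp add: beta_orientation_def \<beta>'_def)
  qed
  \<comment> \<open>Edges of \<open>F\<close> inside \<open>W\<close> cancel, and an end lies in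
    \<open>W\<close> exactly if it collapses to \<open>w\<close>; so the total is the net out-degree
    at \<open>w\<close>.\<close>
  have "(\<Sum>v\<in>W. net_on t h F v) = (\<Sum>e\<in>edges ?K. of_bool (t e \<in> W) - of_bool (h e \<in> W))"
    unfolding sum_net_on[OF fin(1)] using inner
    by (intro sum.mono_neutral_right[OF finF K_sub]) auto
  also have "\<dots> = net_out D w"
  proof -
    have "?c x = w \<longleftrightarrow> x \<in> W" for x
      using wW by (auto simp: collapse_def)
    then show ?thesis
      by (simp add: net_D)
  qed
  also have "\<dots> = (\<Sum>v\<in>W. \<beta> v)"
    using D by (simp add: beta_orientation_def contract_def \<beta>'_def)
  finally have "zero_sum H (\<lambda>v. \<beta> v - net_on t h F v)"
    by (simp add: zero_sum_def W_def sum_subtractf)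
  then obtain D\<^sub>H where DH: "beta_orientation H (\<lambda>v. \<beta> v - net_on t h F v) D\<^sub>H"
    using H(2) unfolding Z3_connected_def by blast
  then have oDH: "verts D\<^sub>H = W" "arcs D\<^sub>H = edges H"
      "\<And>e. e \<in> edges H \<Longrightarrow> ends G e = {tail D\<^sub>H e, head D\<^sub>H e}"
    using ends_H by (auto simp: beta_orientation_def orientation_def W_def)
  define E where "E = \<lparr>verts = vertices G, arcs = edges G,
    tail = \<lambda>e. if e \<in> edges H then tail D\<^sub>H e else t e,
    head = \<lambda>e. if e \<in> edges H then head D\<^sub>H e else h e\<rparr>"
  have "orientation G E"
    unfolding orientation_def E_def using oDH(3) by (simp add: ends_th[symmetric])
  moreover have "net_out E v = \<beta> v" if v: "v \<in> vertices G" for v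
  proof -
    have split: "net_out E v = net_on (tail E) (head E) F v + net_on (tail E) (head E) (edges H) v"
      using HG finF H.finite_edges net_on_Un[of F "edges H" "tail E" "head E" v] finite_edges
        net_out_eq_net_on[of E v]
      by (auto simp: E_def F_def Un_absorb2)
    have "net_on (tail E) (head E) F v = net_on t h F v"
      by (rule net_on_cong) (auto simp: E_def F_def)
    moreover have "net_on (tail E) (head E) (edges H) v
        = net_on (tail D\<^sub>H) (head D\<^sub>H) (edges H) v"
      by (rule net_on_cong) (auto simp: E_def)
    moreover have "net_on (tail D\<^sub>H) (head D\<^sub>H) (edges H) v = \<beta> v - net_on t h F v" if "v \<in> W"
      using that DH net_out_eq_net_on[of D\<^sub>H v] H.finite_edges oDH
      by (simp add: beta_orientation_def W_def)
    moreover have "net_on (tail D\<^sub>H) (head D\<^sub>H) (edges H) v = 0" if "v \<notin> W"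
    proof -
      have "tail D\<^sub>H e \<noteq> v \<and> head D\<^sub>H e \<noteq> v" if "e \<in> edges H" for e
        using that \<open>v \<notin> W\<close> oDH(3)[of e] H.ends_in_vertices[of e] ends_H[of e]
        by (auto simp: W_def)
      then show ?thesis
        by (simp add: net_on_def)
    qed
    ultimately show ?thesis
      using split outside[of v] v by (cases "v \<in> W") auto
  qed
  ultimately show "\<exists>D. beta_orientation G \<beta> D"
    unfolding beta_orientation_def by blast
qed

section \<open>Induction on the number of vertices for (ii)\<close>

lemma (in multigraph) Z3_connected_if_not_nontrivial:
  assumes "\<not> nontrivial G"
  shows "Z3_connected G"
  unfolding Z3_connected_def
proof (intro allI impI)
  fix \<beta> assume zero: "zero_sum G \<beta>"
  have "card (vertices G) = 1"
    using assms finite_vertices vertices_nonempty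
    by (metis card_gt_0_iff One_nat_def Suc_lessI nontrivial_def)
  then obtain v where v: "vertices G = {v}"
    by (auto simp: card_1_singleton_iff)
  have "edges G = {}"
    using nontrivial_if_incident_edges assms card_ends edge_endsE
    by (metis (mono_tags, lifting) empty_Collect_eq equals0I incident_edges_def insertI1)
  \<comment> \<open>Zero sum over a single vertex forces \<open>\<beta> v = 0\<close>, which the
    empty orientation meets.\<close>
  then have "beta_orientation G \<beta> \<lparr>verts = {v}, arcs = {}, tail = \<lambda>_. v, head = \<lambda>_. v\<rparr>"
    using v zero by (simp add: beta_orientation_def orientation_def net_out_eq_net_on net_on_def
        zero_sum_def)
  then show "\<exists>D. beta_orientation G \<beta> D" ..
qed

text \<open>In a nontrivial \<open>G\<close> all degrees are at least 5, so (B) shows that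
  \<open>G\<close> is not reduced. The contraction has fewer vertices because \<open>H\<close> has
  at least two.\<close>

lemma Z3_connected_if_reduced_min_degree:
  fixes G :: "('v, 'e) mgraph"
  assumes B: "\<And>G :: ('v, 'e) mgraph. multigraph G \<Longrightarrow> Z3_reduced G \<Longrightarrow> min_degree G \<le> 4"
    and "multigraph G" "edge_connected 5 G"
  shows "Z3_connected G"
  using assms(2,3)
proof (induction "card (vertices G)" arbitrary: G rule: less_induct)
  case (less G)
  interpret multigraph G
    by fact
  show ?case
  proof (cases "nontrivial G")
    case True
    then have "5 \<le> min_degree G"
      using edge_connected_degree less.prems(2) by (simp add: min_degree_ge_iff)
    then have "\<not> Z3_reduced G"
      using B[OF less.prems(1)] by auto
    then obtain H where H: "subgraph H G" "nontrivial H" "Z3_connected H"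
      unfolding Z3_reduced_def by blast
    then obtain w where w: "w \<in> vertices H"
      by (metis card.empty ex_in_conv nontrivial_def not_less_zero)
    let ?K = "contract G (vertices H) w"
    have sub: "vertices H \<subseteq> vertices G"
      using H(1) by (simp add: subgraph_def)
    have fin: "finite (vertices H)"
      using sub finite_vertices finite_subset by blast
    have "card (vertices ?K) = Suc (card (vertices G) - card (vertices H))"
      using w finite_vertices card_Diff_subset[OF fin sub] by (simp add: contract_def)
    moreover have "card (vertices H) \<le> card (vertices G)"
      using card_mono[OF finite_vertices sub] .
    ultimately have "card (vertices ?K) < card (vertices G)"
      using H(2) by (simp add: nontrivial_def)
    then have "Z3_connected ?K"
      using less.hyps multigraph_contract[OF w sub] edge_connected_contract[OF w sub less.prems(2)]
      by simp
    then show ?thesis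
      using Z3_connected_if_contract H w by blast
  qed (rule Z3_connected_if_not_nontrivial)
qed

section \<open>Attaching a vertex to a set\<close>

definition induced_subgraph :: "('v, 'e) mgraph \<Rightarrow> 'v set \<Rightarrow> ('v, 'e) mgraph" where
  "induced_subgraph G S = G\<lparr>vertices := S, edges := {e \<in> edges G. ends G e \<subseteq> S}\<rparr>"

lemma (in multigraph) subgraph_induced_subgraph:
  assumes "S \<noteq> {}" "S \<subseteq> vertices G"
  shows "subgraph (induced_subgraph G S) G"
  using assms finite_vertices finite_edges card_ends finite_subset[OF assms(2)]
  by (auto simp: subgraph_def multigraph_def induced_subgraph_def)

section \<open>Deleting a vertex at which pre-orientations extend\<close>

lemma (in multigraph) sum_net_out_orientation:
  assumes "orientation G D"
  shows "(\<Sum>v\<in>vertices G. net_out D v) = 0"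
proof -
  have "tail D e \<in> vertices G \<and> head D e \<in> vertices G" if "e \<in> edges G" for e
    using that assms ends_in_vertices[of e] by (auto simp: orientation_def)
  then show ?thesis
    using assms finite_edges
    by (simp add: net_out_eq_net_on sum_net_on[OF finite_vertices] orientation_def)
qed

text \<open>One fixed pre-orientation is extended. Once \<open>\<beta>\<close> is shifted by its net
  out-degrees, an extension stripped of the edges at \<open>z\<close> realises
  \<open>\<beta>\<close>.\<close>

lemma (in multigraph) Z3_connected_delete_extendable_vertex:
  assumes z: "z \<in> vertices G" and ext: "Z3_extendable_at G z"
  shows "Z3_connected (induced_subgraph G (vertices G - {z}))"
  unfolding Z3_connected_def
proof (intro allI impI)
  let ?H = "induced_subgraph G (vertices G - {z})"
  fix \<beta> assume zero: "zero_sum ?H \<beta>"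
  let ?I = "incident_edges G z"
  interpret I: multigraph "G\<lparr>edges := ?I\<rparr>"
    using finite_vertices vertices_nonempty finite_edges ends_in_vertices card_ends
    by (auto simp: multigraph_def incident_edges_def)
  have "\<exists>y. ends G e = {z, y}" if "e \<in> ?I" for e
    using that card_ends[of e] by (auto simp: incident_edges_def card_2_iff doubleton_eq_iff)
  then obtain other where other: "\<And>e. e \<in> ?I \<Longrightarrow> ends G e = {z, other e}"
    by metis
  \<comment> \<open>All edges at \<open>z\<close> point away from it; any fixed choice would
    serve.\<close>
  define D\<^sub>z where "D\<^sub>z = \<lparr>verts = vertices G, arcs = ?I, tail = \<lambda>_. z, head = other\<rparr>"
  have pre: "pre_orientation G z D\<^sub>z"
    using other by (simp add: pre_orientation_def orientation_def D\<^sub>z_def)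
  \<comment> \<open>The demand at \<open>z\<close> is exactly what \<open>D\<^sub>z\<close> gives
    there, and the shift preserves the sum because the net out-degrees of an orientation add up to
    0.\<close>
  define \<beta>' where "\<beta>' v = (if v = z then 0 else \<beta> v) + net_out D\<^sub>z v" for v
  have "(\<Sum>v\<in>vertices G. \<beta>' v) = (\<Sum>v\<in>vertices G. if v = z then 0 else \<beta> v)"
    using I.sum_net_out_orientation pre by (simp add: \<beta>'_def sum.distrib pre_orientation_def)
  also have "\<dots> = (\<Sum>v\<in>vertices G - {z}. \<beta> v)"
    using sum.remove[OF finite_vertices z, of "\<lambda>v. if v = z then 0 else \<beta> v"] by simp
  finally have "zero_sum G \<beta>'"
    using zero by (simp add: zero_sum_def induced_subgraph_def)
  moreover have "net_out D\<^sub>z z = \<beta>' z"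
    by (simp add: \<beta>'_def)
  ultimately obtain D where D: "beta_orientation G \<beta>' D" "extends_orientation D D\<^sub>z"
    using ext pre unfolding Z3_extendable_at_def by blast
  define E where "E = \<lparr>verts = vertices ?H, arcs = edges ?H, tail = tail D, head = head D\<rparr>"
  have fin: "finite ?I" "finite (edges ?H)"
    using finite_edges by (auto simp: incident_edges_def induced_subgraph_def)
  have split: "edges G = edges ?H \<union> ?I" "edges ?H \<inter> ?I = {}"
    using ends_in_vertices by (auto simp: incident_edges_def induced_subgraph_def)
  have "orientation ?H E"
    using D(1) by (auto simp: beta_orientation_def orientation_def E_def induced_subgraph_def)
  moreover have "net_out E v = \<beta> v" if v: "v \<in> vertices ?H" for v
  proof -
    have "net_out D v = net_on (tail D) (head D) (edges ?H \<union> ?I) v"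
      using D(1) fin net_out_eq_net_on[of D v] split(1)
      by (simp add: beta_orientation_def orientation_def)
    also have "\<dots> = net_out E v + net_on (tail D) (head D) ?I v"
      using net_on_Un[OF fin(2,1) split(2)] fin by (simp add: net_out_eq_net_on E_def)
    also have "net_on (tail D) (head D) ?I v = net_on (tail D\<^sub>z) (head D\<^sub>z) ?I v"
      using D(2) by (intro net_on_cong) (auto simp: extends_orientation_def D\<^sub>z_def)
    also have "\<dots> = net_out D\<^sub>z v"
      using fin by (simp add: net_out_eq_net_on D\<^sub>z_def)
    finally show ?thesis
      using D(1) v by (auto simp: beta_orientation_def \<beta>'_def induced_subgraph_def)
  qed
  ultimately show "\<exists>D. beta_orientation ?H \<beta> D"
    unfolding beta_orientation_def by blast
qed

text \<open>Contracts the complement of \<open>S\<close> to \<open>z\<close> and adds the edges \<open>N\<close>, all parallel, between \<open>s\<close>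
  and \<open>z\<close>.\<close>

definition attach :: "('v, 'e) mgraph \<Rightarrow> 'v set \<Rightarrow> 'v \<Rightarrow> 'e set \<Rightarrow> 'v \<Rightarrow> ('v, 'e) mgraph" where
  "attach G S z N s = \<lparr>vertices = insert z S, edges = {e \<in> edges G. ends G e \<inter> S \<noteq> {}} \<union> N,
     ends = \<lambda>e. if e \<in> N then {s, z} else if ends G e \<subseteq> S then ends G e
       else insert z (ends G e \<inter> S)\<rparr>"

text \<open>\<open>z\<close> must avoid \<open>S\<close> only: the vertices of \<open>G\<close>
  outside \<open>S\<close> disappear, so one of them may serve as \<open>z\<close>.
  \<open>N_new\<close> keeps the added edges apart from the old ones.\<close>

locale attached = multigraph +
  fixes S z N s
  assumes S_sub: "S \<subseteq> vertices G" and z: "z \<notin> S" and s: "s \<in> S"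
    and finite_N: "finite N" and N_new: "N \<inter> edges G = {}"
begin

abbreviation "G' \<equiv> attach G S z N s"

lemma multigraph_attach: "multigraph G'"
proof
  fix e assume e: "e \<in> edges G'"
  show "ends G' e \<subseteq> vertices G'"
    using s by (auto simp: attach_def)
  show "card (ends G' e) = 2"
  proof (cases "e \<in> N")
    case True
    then show ?thesis
      using s z by (auto simp: attach_def card_2_iff)
  next
    case False
    then have eG: "e \<in> edges G" "ends G e \<inter> S \<noteq> {}"
      using e by (auto simp: attach_def)
    obtain a b where "ends G e = {a, b}" "a \<noteq> b"
      using edge_endsE[OF eG(1)] by metis
    then show ?thesis
      using False eG(2) z by (cases "a \<in> S"; cases "b \<in> S") (auto simp: attach_def card_2_iff)
  qed
qed (use finite_subset[OF S_sub finite_vertices] finite_edges finite_N in \<open>auto simp: attach_def\<close>)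

lemma incident_edges_attach: "incident_edges G' z = cut_edges G S \<union> N"
proof -
  have "card (ends G e \<inter> S) = 1 \<longleftrightarrow> ends G e \<inter> S \<noteq> {} \<and> \<not> ends G e \<subseteq> S" if e: "e \<in> edges G" for e
  proof -
    obtain a b where ab: "ends G e = {a, b}" "a \<noteq> b"
      using edge_endsE[OF e] by metis
    then show ?thesis
      by (simp add: card_pair_Int_eq_1_iff del: One_nat_def) blast
  qed
  moreover have "z \<in> ends G' e \<longleftrightarrow> \<not> ends G e \<subseteq> S \<or> e \<in> N" for e
    using z by (auto simp: attach_def)
  ultimately show ?thesis
    by (auto simp: incident_edges_def cut_edges_def attach_def)
qed

lemma degree_attach: "degree G' z = card (cut_edges G S) + card N"
  unfolding degree_def incident_edges_attach
  using finite_cut_edges finite_N N_new by (intro card_Un_disjoint) (auto simp: cut_edges_def)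

text \<open>Only ends outside \<open>S\<close> are replaced, so an old edge meets \<open>T\<close>
  as before. Lower bounds on cuts of \<open>G\<close> thus carry over to the new graph.\<close>

lemma cut_edges_attach:
  assumes "T \<subseteq> S"
  shows "cut_edges G T \<subseteq> cut_edges G' T"
proof
  fix e assume "e \<in> cut_edges G T"
  then have e: "e \<in> edges G" "card (ends G e \<inter> T) = 1"
    by (auto simp: cut_edges_def)
  have "ends G e \<inter> T \<noteq> {}"
    using e(2) by auto
  then have "ends G e \<inter> S \<noteq> {}"
    using assms by blast
  moreover have "ends G' e \<inter> T = ends G e \<inter> T"
    using e(1) N_new z assms by (auto simp: attach_def)
  ultimately show "e \<in> cut_edges G' T"
    using e by (simp add: cut_edges_def attach_def)
qed

text \<open>The two records may differ in \<open>ends\<close> away from their edges, so they need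
  not be equal; \<open>Z3_connected\<close> depends on \<open>ends\<close> only at edges.\<close>

lemma induced_subgraph_attach:
  "Z3_connected (induced_subgraph G' (vertices G' - {z})) \<longleftrightarrow> Z3_connected (induced_subgraph G S)"
proof -
  let ?H' = "induced_subgraph G' (vertices G' - {z})" and ?H = "induced_subgraph G S"
  have "vertices G' - {z} = S"
    using z by (auto simp: attach_def)
  moreover have "{e \<in> edges G'. ends G' e \<subseteq> S} = {e \<in> edges G. ends G e \<subseteq> S}"
  proof -
    have "ends G e \<inter> S \<noteq> {}" if "e \<in> edges G" "ends G e \<subseteq> S" for e
      using card_ends[OF that(1)] that(2) by (auto simp: Int_absorb2)
    then show ?thesis
      using z N_new by (auto simp: attach_def split: if_splits)
  qed
  ultimately have "vertices ?H' = vertices ?H" "edges ?H' = edges ?H"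
    by (auto simp: induced_subgraph_def)
  moreover have "ends ?H' e = ends ?H e" if "e \<in> edges ?H" for e
    using that N_new by (auto simp: induced_subgraph_def attach_def)
  ultimately show ?thesis
    by (simp add: Z3_connected_def zero_sum_def beta_orientation_def orientation_def)
qed

end

section \<open>The minimal set argument for (i)\<close>

text \<open>The threshold 5 in the choice of \<open>S\<close> matters twice: it lets
  \<open>z\<close> be filled up to degree 5, and minimality then forces 6 leaving edges on smaller
  sets of at least two vertices. The infinite types supply \<open>z\<close> and the new
  edges.\<close>

lemma min_degree_if_extendable:
  fixes G :: "('v::infinite, 'e::infinite) mgraph"
  assumes A: "\<And>(G :: ('v, 'e) mgraph) z. multigraph G \<Longrightarrow> edge_connected 5 G \<Longrightarrow>
      essentially_edge_connected 6 G \<Longrightarrow> z \<in> vertices G \<Longrightarrow> degree G z = 5 \<Longrightarrow> Z3_extendable_at G z"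
    and "multigraph G" "Z3_reduced G"
  shows "min_degree G \<le> 4"
proof (rule ccontr)
  interpret multigraph G
    by fact
  assume "\<not> min_degree G \<le> 4"
  then have "5 \<le> min_degree G"
    by simp
  then have deg: "5 \<le> degree G v" if "v \<in> vertices G" for v
    using that by (simp add: min_degree_ge_iff)
  let ?P = "\<lambda>T. T \<subseteq> vertices G \<and> 2 \<le> card T \<and> card (cut_edges G T) \<le> 5"
  obtain v where "v \<in> vertices G"
    using vertices_nonempty by blast
  then have "incident_edges G v \<noteq> {}"
    using deg[of v] by (auto simp: degree_def)
  \<comment> \<open>The whole vertex set has an empty cut, and an edge at \<open>v\<close> shows
    that it has at least two elements.\<close>
  then have "?P (vertices G)"
    using nontrivial_if_incident_edges[of v] by (simp add: nontrivial_def cut_edges_vertices)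
  then obtain S where S: "?P S" and S_min: "\<And>T. ?P T \<Longrightarrow> card S \<le> card T"
    using ex_has_least_nat[of ?P "vertices G" card] by blast
  have finS: "finite S"
    using S finite_vertices finite_subset by blast
  then obtain z where z: "z \<notin> S"
    using ex_new_if_finite infinite_UNIV by metis
  obtain s where s: "s \<in> S"
    using S by fastforce
  have "infinite (UNIV - edges G)"
    using finite_edges infinite_UNIV by (simp add: Diff_infinite_finite)
  \<comment> \<open>The subtraction of naturals is exact, since at most 5 edges leave
    \<open>S\<close>.\<close>
  then obtain N where N: "N \<subseteq> UNIV - edges G" "finite N" "card N = 5 - card (cut_edges G S)"
    by (metis infinite_arbitrarily_large)
  interpret attached G S z N s
    using S z s N by unfold_locales auto
  interpret G': multigraph G'
    by (rule multigraph_attach)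
  have degz: "degree G' z = 5"
    using S N(3) by (simp add: degree_attach)
  have vG': "vertices G' = insert z S"
    by (simp add: attach_def)
  have big: "6 \<le> card (cut_edges G' T)" if T: "T \<subset> S" "2 \<le> card T" for T
  proof -
    have "\<not> card (cut_edges G T) \<le> 5"
      using S_min[of T] psubset_card_mono[OF finS T(1)] T S by fastforce
    then show ?thesis
      using card_mono[OF G'.finite_cut_edges cut_edges_attach[of T]] T by auto
  qed
  have small: "5 \<le> card (cut_edges G' T)" if T: "T \<subseteq> S" "T \<noteq> {}" for T
  proof -
    \<comment> \<open>\<open>S\<close> is the complement of \<open>z\<close>, which has degree 5;
      smaller sets of at least two vertices use minimality, and singletons the minimum degree of
      \<open>G\<close>.\<close>
    consider "T = S" | "T \<subset> S" "2 \<le> card T" | v where "T = {v}"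
    proof -
      have "card T \<noteq> 0"
        using T finite_subset[OF T(1) finS] by simp
      then have "card T = 1 \<or> 2 \<le> card T"
        by linarith
      then show ?thesis
        using that T by (auto simp: card_1_singleton_iff)
    qed
    then show ?thesis
    proof cases
      case 1
      have "vertices G' - {z} = S"
        using z by (auto simp: vG')
      then show ?thesis
        using 1 degz G'.cut_edges_Diff[of "{z}"] by (simp add: degree_def cut_edges_singleton)
    next
      case 2
      then show ?thesis
        using big[of T] by simp
    next
      case 3
      then have "5 \<le> card (cut_edges G T)"
        using deg[of v] T S by (auto simp: degree_def cut_edges_singleton)
      then show ?thesis
        using card_mono[OF G'.finite_cut_edges cut_edges_attach[of T]] T by linarith
    qed
  qed
  have conn: "edge_connected 5 G'"
  proof (rule G'.edge_connectedI)
    fix T assume T: "T \<noteq> {}" "T \<subset> vertices G'"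
    show "5 \<le> card (cut_edges G' T)"
    \<comment> \<open>A set and its complement have the same cut, so bounds for sets avoiding
      \<open>z\<close> suffice.\<close>
    proof (cases "z \<in> T")
      case True
      then have "vertices G' - T \<subseteq> S" "vertices G' - T \<noteq> {}"
        using T by (auto simp: vG')
      then show ?thesis
        using small[of "vertices G' - T"] by (simp add: G'.cut_edges_Diff)
    next
      case False
      then show ?thesis
        using small[of T] T by (auto simp: vG')
    qed
  qed simp
  have "essentially_edge_connected 6 G'"
  proof (rule G'.essentially_edge_connectedI[where z = z])
    show "connected_graph G'"
      using conn by (simp add: edge_connected_def)
    show "6 \<le> card (cut_edges G' T)" if "T \<subset> vertices G' - {z}" "2 \<le> card T" for T
      using that big[of T] z by (simp add: vG')
  qed
  then have "Z3_extendable_at G' z"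
    using A multigraph_attach conn degz by (simp add: vG')
  then have "Z3_connected (induced_subgraph G S)"
    using G'.Z3_connected_delete_extendable_vertex[of z] induced_subgraph_attach vG' by blast
  moreover have "subgraph (induced_subgraph G S) G"
    using S s by (intro subgraph_induced_subgraph) auto
  moreover have "nontrivial (induced_subgraph G S)"
    using S by (simp add: nontrivial_def induced_subgraph_def)
  ultimately show False
    using assms(3) unfolding Z3_reduced_def by blast
qed

(* Over infinite vertex and edge types every finite graph occurs up to isomorphism, so each
   quantifier over G ranges over all graphs. *)

theorem proposition3p3:
  shows "((\<forall>G :: ('v::infinite, 'e::infinite) mgraph.
             multigraph G \<and> edge_connected 5 G \<and> essentially_edge_connected 6 G \<longrightarrow>
             (\<forall>z\<in>vertices G. degree G z = 5 \<longrightarrow> Z3_extendable_at G z)) \<longrightarrow>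
          (\<forall>G :: ('v, 'e) mgraph. multigraph G \<and> Z3_reduced G \<longrightarrow> min_degree G \<le> 4)) \<and>
         ((\<forall>G :: ('v, 'e) mgraph. multigraph G \<and> Z3_reduced G \<longrightarrow> min_degree G \<le> 4) \<longrightarrow>
          (\<forall>G :: ('v, 'e) mgraph. multigraph G \<and> edge_connected 5 G \<longrightarrow> Z3_connected G))"
  using min_degree_if_extendable Z3_connected_if_reduced_min_degree by blast

end
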